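(* Let $\Gamma=\mathrm{SC}(G,R,L,S)$ be a semi-Cayley graph over a finite abelian group $G$ of order $n$, and let $\alpha,\beta$ be nonzero complex numbers. Let $X=\{z\in G:\chi_z(S)=0\}$. Then $(\alpha,\beta)$-revival occurs on $\Gamma$ from a vertex $u=(g,0)$ to a vertex $v=(h,1)$ at time $t$ if and only if, with $a=g^{-1}h$: (a) $X=\emptyset$ and $\chi_z(S)\chi_a(z)\in\mathbb{R}$ for all $z\in G$; and (b) for all $z\in G$, $\exp(\imath t\lambda_z^+)=\alpha+c_z^-(e_z^+)^{-1}\beta\,\overline{\chi_a(z)}$ and $\exp(\imath t\lambda_z^-)=\alpha-c_z^+(e_z^+)^{-1}\beta\,\overline{\chi_a(z)}$.
   Context: $G$ is a finite abelian group of order $n$, written multiplicatively with identity $1$, identified with $\mathbb{Z}_{n_1}\otimes\cdots\otimes\mathbb{Z}_{n_r}$. For $z=(z_1,\dots,z_r)$, $g=(g_1,\dots,g_r)$ in $G$, $\chi_z(g)=\prod_{s=1}^r\omega_{n_s}^{z_sg_s}$ with $\omega_m=\exp(2\pi\imath/m)$; note $\chi_z(g)=\chi_g(z)$. For $Y\subseteq G$, $\chi_z(Y)=\sum_{y\in Y}\chi_z(y)$. $R,L,S\subseteq G$ with $R=R^{-1}$, $L=L^{-1}$, $1\notin R\cup L$. The semi-Cayley graph $\mathrm{SC}(G,R,L,S)$ has vertex set $\{(g,0),(g,1):g\in G\}$ and edges $\{(g,0),(h,0)\}$ for $hg^{-1}\in R$, $\{(g,1),(h,1)\}$ for $hg^{-1}\in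 L$, $\{(g,0),(h,1)\}$ for $hg^{-1}\in S$. For $z\in G$, $\lambda_z^\pm=\frac12\left(\chi_z(R)+\chi_z(L)\pm\sqrt{(\chi_z(R)-\chi_z(L))^2+4|\chi_z(S)|^2}\right)$. Let $x_z=\chi_z(R)-\chi_z(L)\in\mathbb{R}$ and $D_z=\sqrt{x_z^2+4|\chi_z(S)|^2}$. For $z$ with $\chi_z(S)\neq0$ define $c_z^\pm=\dfrac{|x_z\pm D_z|^2}{|x_z\pm D_z|^2+4|\chi_z(S)|^2}$ and $e_z^+=\dfrac{2\chi_z(S)(x_z+D_z)}{|x_z+D_z|^2+4|\chi_z(S)|^2}$. The transition matrix is $H(t)=\exp(\imath tA)$, $A$ the adjacency matrix. For distinct vertices $u,v$, $(\alpha,\beta)$-revival occurs from $u$ to $v$ at time $t$ if $H(t)\mathbf{e}_u=\alpha\mathbf{e}_u+\beta\mathbf{e}_v$ with $|\alpha|^2+|\beta|^2=1$.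
   Formalization: The formal theorem takes a = gh⁻¹ instead of a = g⁻¹h; with a = g⁻¹h the claim fails, e.g. for G = Z₃, R = L = ∅, S = {1}, u = (0,0), v = (1,1), t = π/4, where revival occurs but χ_z(S)χ_a(z) is not real. *)

theory Defs
  imports "HOL-Analysis.Analysis" "HOL-Algebra.Elementary_Groups" "HOL-Algebra.Product_Groups"
begin

section \<open>Matrices indexed by a finite set and graphs\<close>

text \<open>A matrix with rows and columns indexed by a finite set \<open>V\<close> is a function
  \<open>'v \<Rightarrow> 'v \<Rightarrow> complex\<close> of which only the entries in \<open>V \<times> V\<close> matter.\<close>

primrec mpow :: "'v set \<Rightarrow> ('v \<Rightarrow> 'v \<Rightarrow> complex) \<Rightarrow> nat \<Rightarrow> 'v \<Rightarrow> 'v \<Rightarrow> complex" where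
  "mpow V M 0 = (\<lambda>u v. if u = v then 1 else 0)"
| "mpow V M (Suc k) = (\<lambda>u v. \<Sum>w\<in>V. M u w * mpow V M k w v)"

definition mexp :: "'v set \<Rightarrow> ('v \<Rightarrow> 'v \<Rightarrow> complex) \<Rightarrow> 'v \<Rightarrow> 'v \<Rightarrow> complex" where
  "mexp V M u v = suminf (\<lambda>k. mpow V M k u v / fact k)"

definition mvec :: "'v set \<Rightarrow> ('v \<Rightarrow> 'v \<Rightarrow> complex) \<Rightarrow> ('v \<Rightarrow> complex) \<Rightarrow> 'v \<Rightarrow> complex" where
  "mvec V M f u = (\<Sum>w\<in>V. M u w * f w)"

definition unit_vec :: "'v \<Rightarrow> 'v \<Rightarrow> complex" where
  "unit_vec u = (\<lambda>w. if w = u then 1 else 0)"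

lemma norm_mpow_le:
  assumes "finite V" and M: "\<And>u v. u \<in> V \<Longrightarrow> v \<in> V \<Longrightarrow> norm (M u v) \<le> B" and "B \<ge> 0"
    and "u \<in> V" "v \<in> V"
  shows "norm (mpow V M k u v) \<le> (real (card V) * B) ^ k"
  using \<open>u \<in> V\<close>
proof (induction k arbitrary: u)
  case 0
  then show ?case by simp
next
  case (Suc k)
  have "norm (mpow V M (Suc k) u v) \<le> (\<Sum>w\<in>V. norm (M u w * mpow V M k w v))"
    by (simp add: norm_sum)
  also have "\<dots> \<le> (\<Sum>w\<in>V. B * (real (card V) * B) ^ k)"
    unfolding norm_mult using Suc M \<open>B \<ge> 0\<close> by (intro sum_mono mult_mono) auto
  also have "\<dots> = (real (card V) * B) ^ Suc k" by simp
  finally show ?case .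
qed

text \<open>The series in \<open>mexp\<close> converges, so the entries of \<open>mexp\<close> are genuine sums.\<close>

lemma summable_mexp:
  assumes "finite V" "u \<in> V" "v \<in> V"
  shows "summable (\<lambda>k. mpow V M k u v / fact k)"
proof -
  define B where "B = (\<Sum>x\<in>V. \<Sum>y\<in>V. norm (M x y))"
  have B0: "B \<ge> 0" unfolding B_def by (intro sum_nonneg) auto
  have MB: "norm (M x y) \<le> B" if "x \<in> V" "y \<in> V" for x y
  proof -
    have "norm (M x y) \<le> (\<Sum>y\<in>V. norm (M x y))"
      using that \<open>finite V\<close> by (intro member_le_sum) auto
    also have "\<dots> \<le> B"
      unfolding B_def using that \<open>finite V\<close>
      by (intro member_le_sum[where f = "\<lambda>x. \<Sum>y\<in>V. norm (M x y)"]) (auto intro: sum_nonneg)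
    finally show ?thesis .
  qed
  show ?thesis
  proof (rule summable_comparison_test')
    show "summable (\<lambda>k. inverse (fact k) * (real (card V) * B) ^ k)"
      by (rule summable_exp)
    show "norm (mpow V M k u v / fact k) \<le> inverse (fact k) * (real (card V) * B) ^ k"
      for k
      using norm_mpow_le[OF \<open>finite V\<close> MB B0 \<open>u \<in> V\<close> \<open>v \<in> V\<close>, where k = k]
      by (simp add: norm_divide divide_simps)
  qed
qed

text \<open>A graph is a vertex set with a set of edges, an edge being the set of its two endpoints.\<close>

definition adjacency :: "'v set set \<Rightarrow> 'v \<Rightarrow> 'v \<Rightarrow> complex" where
  "adjacency E u v = (if {u, v} \<in> E then 1 else 0)"

definition transition_matrix ::
    "'v set \<Rightarrow> 'v set set \<Rightarrow> real \<Rightarrow> 'v \<Rightarrow> 'v \<Rightarrow> complex" where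
  "transition_matrix V E t = mexp V (\<lambda>u v. \<i> * of_real t * adjacency E u v)"

definition revival ::
    "'v set \<Rightarrow> 'v set set \<Rightarrow> complex \<Rightarrow> complex \<Rightarrow> 'v \<Rightarrow> 'v \<Rightarrow> real \<Rightarrow> bool" where
  "revival V E \<alpha> \<beta> u v t \<longleftrightarrow>
     u \<in> V \<and> v \<in> V \<and> u \<noteq> v \<and>
     (\<forall>w\<in>V. mvec V (transition_matrix V E t) (unit_vec u) w = \<alpha> * unit_vec u w + \<beta> * unit_vec v w) \<and>
     (cmod \<alpha>)\<^sup>2 + (cmod \<beta>)\<^sup>2 = 1"


section \<open>Semi-Cayley graphs\<close>

definition sc_verts :: "('a, 'm) monoid_scheme \<Rightarrow> ('a \<times> nat) set" where
  "sc_verts G = carrier G \<times> {0, 1}"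

definition sc_edges ::
    "('a, 'm) monoid_scheme \<Rightarrow> 'a set \<Rightarrow> 'a set \<Rightarrow> 'a set \<Rightarrow> ('a \<times> nat) set set" where
  "sc_edges G R L S =
     {{(g, 0), (h, 0)} | g h. g \<in> carrier G \<and> h \<in> carrier G \<and> h \<otimes>\<^bsub>G\<^esub> inv\<^bsub>G\<^esub> g \<in> R} \<union>
     {{(g, 1), (h, 1)} | g h. g \<in> carrier G \<and> h \<in> carrier G \<and> h \<otimes>\<^bsub>G\<^esub> inv\<^bsub>G\<^esub> g \<in> L} \<union>
     {{(g, 0), (h, 1)} | g h. g \<in> carrier G \<and> h \<in> carrier G \<and> h \<otimes>\<^bsub>G\<^esub> inv\<^bsub>G\<^esub> g \<in> S}"


section \<open>Characters\<close>

text \<open>The identification of \<open>G\<close> with a product of cyclic groups is carried by an isomorphism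
  \<open>\<phi> \<in> iso G (cyclic_product r ns)\<close>; \<open>\<phi> g s\<close> is the \<open>s\<close>-th coordinate of \<open>g\<close>, with \<open>s\<close> counted
  from 0.\<close>

definition cyclic_product :: "nat \<Rightarrow> (nat \<Rightarrow> nat) \<Rightarrow> (nat \<Rightarrow> int) monoid" where
  "cyclic_product r ns = product_group {..<r} (\<lambda>s. integer_mod_group (ns s))"

definition omega :: "nat \<Rightarrow> complex" where
  "omega m = exp (2 * of_real pi * \<i> / of_nat m)"

definition chi :: "nat \<Rightarrow> (nat \<Rightarrow> nat) \<Rightarrow> ('a \<Rightarrow> nat \<Rightarrow> int) \<Rightarrow> 'a \<Rightarrow> 'a \<Rightarrow> complex" where
  "chi r ns \<phi> z g = (\<Prod>s<r. omega (ns s) powi (\<phi> z s * \<phi> g s))"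

definition chi_set :: "('a \<Rightarrow> 'a \<Rightarrow> complex) \<Rightarrow> 'a \<Rightarrow> 'a set \<Rightarrow> complex" where
  "chi_set ch z Y = (\<Sum>y\<in>Y. ch z y)"


section \<open>Spectral data\<close>

text \<open>The numbers \<open>sc_x\<close> are real when \<open>R\<close> and \<open>L\<close> are closed under inversion, so that
  \<open>csqrt\<close> in \<open>sc_D\<close> is the nonnegative square root of a nonnegative real number.\<close>

definition sc_x :: "('a \<Rightarrow> 'a \<Rightarrow> complex) \<Rightarrow> 'a set \<Rightarrow> 'a set \<Rightarrow> 'a \<Rightarrow> complex" where
  "sc_x ch R L z = chi_set ch z R - chi_set ch z L"

definition sc_D :: "('a \<Rightarrow> 'a \<Rightarrow> complex) \<Rightarrow> 'a set \<Rightarrow> 'a set \<Rightarrow> 'a set \<Rightarrow> 'a \<Rightarrow> complex" where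
  "sc_D ch R L S z = csqrt ((sc_x ch R L z)\<^sup>2 + 4 * of_real ((cmod (chi_set ch z S))\<^sup>2))"

definition lam_plus :: "('a \<Rightarrow> 'a \<Rightarrow> complex) \<Rightarrow> 'a set \<Rightarrow> 'a set \<Rightarrow> 'a set \<Rightarrow> 'a \<Rightarrow> complex" where
  "lam_plus ch R L S z = (chi_set ch z R + chi_set ch z L + sc_D ch R L S z) / 2"

definition lam_minus :: "('a \<Rightarrow> 'a \<Rightarrow> complex) \<Rightarrow> 'a set \<Rightarrow> 'a set \<Rightarrow> 'a set \<Rightarrow> 'a \<Rightarrow> complex" where
  "lam_minus ch R L S z = (chi_set ch z R + chi_set ch z L - sc_D ch R L S z) / 2"

definition c_plus :: "('a \<Rightarrow> 'a \<Rightarrow> complex) \<Rightarrow> 'a set \<Rightarrow> 'a set \<Rightarrow> 'a set \<Rightarrow> 'a \<Rightarrow> real" where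
  "c_plus ch R L S z =
     (cmod (sc_x ch R L z + sc_D ch R L S z))\<^sup>2 /
     ((cmod (sc_x ch R L z + sc_D ch R L S z))\<^sup>2 + 4 * (cmod (chi_set ch z S))\<^sup>2)"

definition c_minus :: "('a \<Rightarrow> 'a \<Rightarrow> complex) \<Rightarrow> 'a set \<Rightarrow> 'a set \<Rightarrow> 'a set \<Rightarrow> 'a \<Rightarrow> real" where
  "c_minus ch R L S z =
     (cmod (sc_x ch R L z - sc_D ch R L S z))\<^sup>2 /
     ((cmod (sc_x ch R L z - sc_D ch R L S z))\<^sup>2 + 4 * (cmod (chi_set ch z S))\<^sup>2)"

definition e_plus :: "('a \<Rightarrow> 'a \<Rightarrow> complex) \<Rightarrow> 'a set \<Rightarrow> 'a set \<Rightarrow> 'a set \<Rightarrow> 'a \<Rightarrow> complex" where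
  "e_plus ch R L S z =
     2 * chi_set ch z S * (sc_x ch R L z + sc_D ch R L S z) /
     of_real ((cmod (sc_x ch R L z + sc_D ch R L S z))\<^sup>2 + 4 * (cmod (chi_set ch z S))\<^sup>2)"

text \<open>Pitfall: for revival from \<open>(g, 0)\<close> to \<open>(h, 1)\<close>, and with edges \<open>{(g, 0), (h, 1)}\<close> for
  \<open>h g\<^sup>-\<^sup>1 \<in> S\<close>, the element \<open>a\<close> in the conditions \<open>\<chi>\<^sub>z(S) \<chi>\<^sub>a(z) \<in> \<real>\<close> and
  \<open>exp (\<i> t \<lambda>\<^sub>z\<^sup>+) = \<alpha> + c\<^sub>z\<^sup>- (e\<^sub>z\<^sup>+)\<^sup>-\<^sup>1 \<beta> cnj (\<chi>\<^sub>a(z))\<close> is \<open>a = g h\<^sup>-\<^sup>1\<close>; for \<open>a = g\<^sup>-\<^sup>1 h\<close> they would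
  not be equivalent to revival. Take \<open>G\<close> cyclic of order 3, \<open>R = L = {}\<close>, \<open>S = {s}\<close> with \<open>s \<noteq> 1\<close>:
  the graph is a perfect matching, revival occurs from \<open>(1, 0)\<close> to \<open>(s, 1)\<close> with
  \<open>\<alpha> = cos t\<close>, \<open>\<beta> = \<i> sin t\<close>, but \<open>\<chi>\<^sub>z(S) \<chi>\<^sub>s(z) = \<chi>\<^sub>z(s)\<^sup>2\<close> is not real for \<open>z \<noteq> 1\<close>.\<close>

end

theory Submission
  imports Defs
begin

text \<open>The Fourier transform on \<open>G\<close> splits the adjacency matrix into the blocks
  \<open>((\<chi>\<^sub>z(R), \<chi>\<^sub>z(S)), (cnj (\<chi>\<^sub>z(S)), \<chi>\<^sub>z(L)))\<close> for \<open>z \<in> G\<close>, with eigenvalues \<open>\<lambda>\<^sub>z\<^sup>+\<close>, \<open>\<lambda>\<^sub>z\<^sup>-\<close>. If \<open>\<chi>\<^sub>z(S) \<noteq> 0\<close>,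
  the spectral projection for \<open>\<lambda>\<^sub>z\<^sup>+\<close> is \<open>((c\<^sub>z\<^sup>+, e\<^sub>z\<^sup>+), (cnj e\<^sub>z\<^sup>+, c\<^sub>z\<^sup>-))\<close>, so with \<open>p, m\<close> the exponentials of
  \<open>\<i>t\<lambda>\<^sub>z\<^sup>+\<close>, \<open>\<i>t\<lambda>\<^sub>z\<^sup>-\<close>, revival says that \<open>c\<^sub>z\<^sup>+ p + c\<^sub>z\<^sup>- m = \<alpha>\<close> and \<open>cnj e\<^sub>z\<^sup>+ (p - m) = \<beta> \<chi>\<^sub>a(z)\<close> for all
  \<open>z\<close>; if \<open>\<chi>\<^sub>z(S) = 0\<close>, the block is diagonal and \<open>\<beta>\<close> would vanish. Comparing these equations at \<open>z\<close>
  and \<open>z\<^sup>-\<^sup>1\<close> forces \<open>e\<^sub>z\<^sup>+ \<chi>\<^sub>a(z)\<close> to be real, and then the system solves to the stated values of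
  \<open>p\<close> and \<open>m\<close>. Conversely \<open>|\<alpha>|\<^sup>2 + |\<beta>|\<^sup>2 = 1\<close> follows from the unitarity of a single block.\<close>

section \<open>Bicharacters and the Fourier transform\<close>

text \<open>Only these properties of \<open>chi\<close> enter before the last section. Symmetry and
  modulus are asked of all elements of the type, which saves membership conditions; nondegeneracy
  yields orthogonality.\<close>

locale bicharacter = comm_group G for G :: "('a, 'm) monoid_scheme" (structure) +
  fixes ch :: "'a \<Rightarrow> 'a \<Rightarrow> complex"
  assumes finite_carrier: "finite (carrier G)"
    and ch_mult: "z \<in> carrier G \<Longrightarrow> x \<in> carrier G \<Longrightarrow> y \<in> carrier G \<Longrightarrow> ch z (x \<otimes> y) = ch z x * ch z y"
    and ch_commute: "ch z x = ch x z"
    and cmod_ch: "cmod (ch z x) = 1"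
    and ch_nondegenerate: "x \<in> carrier G \<Longrightarrow> x \<noteq> \<one> \<Longrightarrow> \<exists>z\<in>carrier G. ch z x \<noteq> 1"
begin

section \<open>Values of a bicharacter and its sums over sets\<close>

lemma ch_nonzero: "ch z x \<noteq> 0"
  using cmod_ch[of z x] by auto

lemma ch_one:
  assumes "z \<in> carrier G"
  shows "ch z \<one> = 1"
  using ch_mult[OF assms one_closed one_closed] ch_nonzero[of z \<one>] by simp

lemma ch_mult_cnj: "ch z x * cnj (ch z x) = 1"
  by (simp add: complex_norm_square[symmetric] cmod_ch)

lemma ch_inv:
  assumes "z \<in> carrier G" "x \<in> carrier G"
  shows "ch z (inv x) = cnj (ch z x)"
proof -
  have "ch z x * ch z (inv x) = ch z x * cnj (ch z x)"
    using ch_mult[of z x "inv x"] ch_one assms by (simp add: ch_mult_cnj)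
  then show ?thesis
    using ch_nonzero by simp
qed

lemma ch_inv_left:
  assumes "z \<in> carrier G" "x \<in> carrier G"
  shows "ch (inv z) x = cnj (ch z x)"
  using ch_inv[OF assms(2,1)] by (simp add: ch_commute)

lemma chi_set_inv_left:
  assumes "z \<in> carrier G" "Y \<subseteq> carrier G"
  shows "chi_set ch (inv z) Y = cnj (chi_set ch z Y)"
  using assms by (auto simp: chi_set_def ch_inv_left subset_eq intro!: sum.cong)

lemma chi_set_set_inv:
  assumes "z \<in> carrier G" "Y \<subseteq> carrier G"
  shows "chi_set ch z (set_inv Y) = cnj (chi_set ch z Y)"
proof -
  have "set_inv Y = (\<lambda>y. inv y) ` Y"
    by (auto simp: SET_INV_def)
  moreover have "inj_on (\<lambda>y. inv y) Y"
    using assms(2) inv_inj by (rule inj_on_subset[rotated])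
  ultimately show ?thesis
    using assms by (auto simp: chi_set_def sum.reindex ch_inv subset_eq intro!: sum.cong)
qed

text \<open>For \<open>x \<noteq> \<one>\<close> some \<open>y\<close> has
  \<open>ch y x \<noteq> 1\<close>; translating the summation index by \<open>y\<close> preserves
  the sum but multiplies it by \<open>ch y x\<close>, so it vanishes.\<close>

lemma sum_ch:
  assumes "x \<in> carrier G"
  shows "(\<Sum>z\<in>carrier G. ch z x) = (if x = \<one> then of_nat (order G) else 0)"
proof (cases "x = \<one>")
  case True
  then show ?thesis
    by (simp add: ch_one order_def)
next
  case False
  then obtain y where y: "y \<in> carrier G" "ch y x \<noteq> 1"
    using ch_nondegenerate assms by blast
  have "(\<Sum>z\<in>carrier G. ch z x) = (\<Sum>z\<in>carrier G. ch (y \<otimes> z) x)"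
    by (rule sum.reindex_bij_witness[of _ "\<lambda>z. y \<otimes> z" "\<lambda>z. inv y \<otimes> z"])
      (use y in \<open>auto simp: m_assoc[symmetric]\<close>)
  also have "\<dots> = (\<Sum>z\<in>carrier G. ch y x * ch z x)"
    using y assms by (intro sum.cong) (simp_all add: ch_commute[of _ x] ch_mult)
  also have "\<dots> = ch y x * (\<Sum>z\<in>carrier G. ch z x)"
    by (simp add: sum_distrib_left)
  finally show ?thesis
    using y False by simp
qed

text \<open>Unnormalised, so inversion carries the factor \<open>order G\<close>. The conjugate in
  the kernel makes \<open>fourier_convolution\<close> produce \<open>chi_set ch z Y\<close> and not
  its conjugate.\<close>

definition fourier :: "('a \<Rightarrow> complex) \<Rightarrow> 'a \<Rightarrow> complex" where
  "fourier f z = (\<Sum>y\<in>carrier G. cnj (ch z y) * f y)"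

lemma fourier_inversion:
  assumes "x \<in> carrier G"
  shows "(\<Sum>z\<in>carrier G. ch z x * fourier f z) = of_nat (order G) * f x"
proof -
  have "(\<Sum>z\<in>carrier G. ch z x * fourier f z)
      = (\<Sum>z\<in>carrier G. \<Sum>y\<in>carrier G. ch z (x \<otimes> inv y) * f y)"
    unfolding fourier_def sum_distrib_left
    using assms by (intro sum.cong) (auto simp: ch_mult ch_inv)
  also have "\<dots> = (\<Sum>y\<in>carrier G. (\<Sum>z\<in>carrier G. ch z (x \<otimes> inv y)) * f y)"
    by (subst sum.swap) (simp add: sum_distrib_right)
  also have "\<dots> = (\<Sum>y\<in>carrier G. if y = x then of_nat (order G) * f x else 0)"
  proof (intro sum.cong refl)
    fix y assume y: "y \<in> carrier G"
    then have "x \<otimes> inv y = \<one> \<longleftrightarrow> y = x"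
      using assms by (metis inv_closed inv_equality inv_inv r_inv)
    then show "(\<Sum>z\<in>carrier G. ch z (x \<otimes> inv y)) * f y
        = (if y = x then of_nat (order G) * f x else 0)"
      using assms y by (simp add: sum_ch)
  qed
  finally show ?thesis
    using assms finite_carrier by simp
qed

text \<open>Inversion recovers a function from its transform, so vector identities can be tested one
  frequency at a time.\<close>

lemma fourier_eq_iff:
  "(\<forall>z\<in>carrier G. fourier f z = fourier f' z) \<longleftrightarrow> (\<forall>x\<in>carrier G. f x = f' x)"
proof
  assume eq: "\<forall>z\<in>carrier G. fourier f z = fourier f' z"
  have "order G \<noteq> 0"
    using finite_carrier order_gt_0_iff_finite by simp
  moreover have "complex_of_nat (order G) * f x = of_nat (order G) * f' x" if "x \<in> carrier G" for x
    unfolding fourier_inversion[OF that, symmetric] using eq by (intro sum.cong) auto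
  ultimately show "\<forall>x\<in>carrier G. f x = f' x"
    by (metis mult_left_cancel of_nat_eq_0_iff)
next
  assume "\<forall>x\<in>carrier G. f x = f' x"
  then show "\<forall>z\<in>carrier G. fourier f z = fourier f' z"
    by (auto simp: fourier_def intro!: sum.cong)
qed

lemma fourier_delta:
  assumes "y \<in> carrier G"
  shows "fourier (\<lambda>x. if x = y then c else 0) z = c * cnj (ch z y)"
proof -
  have "fourier (\<lambda>x. if x = y then c else 0) z
      = (\<Sum>x\<in>carrier G. if x = y then c * cnj (ch z y) else 0)"
    unfolding fourier_def by (intro sum.cong) auto
  then show ?thesis
    using assms finite_carrier by simp
qed

text \<open>The kernel depends on \<open>y \<otimes> inv x\<close> only, so the operator commutes
  with translations and characters diagonalise it.\<close>

lemma fourier_convolution: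
  assumes "z \<in> carrier G" "Y \<subseteq> carrier G"
  shows "fourier (\<lambda>x. \<Sum>y\<in>carrier G. (if y \<otimes> inv x \<in> Y then 1 else 0) * f y) z
    = chi_set ch z Y * fourier f z"
proof -
  have translate: "(\<Sum>x\<in>carrier G. cnj (ch z x) * (if y \<otimes> inv x \<in> Y then 1 else 0))
      = chi_set ch z Y * cnj (ch z y)" if y: "y \<in> carrier G" for y
  proof -
    have "(\<Sum>x\<in>carrier G. cnj (ch z x) * (if y \<otimes> inv x \<in> Y then 1 else 0))
        = (\<Sum>x | x \<in> carrier G \<and> y \<otimes> inv x \<in> Y. cnj (ch z x))"
      by (rule sum.mono_neutral_cong_right) (use finite_carrier in auto)
    \<comment> \<open>Substitute \<open>v = y \<otimes> inv x\<close>; then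
      \<open>cnj (ch z x)\<close> factors as \<open>ch z v * cnj (ch z y)\<close>.\<close>
    also have "\<dots> = (\<Sum>v\<in>Y. ch z v * cnj (ch z y))"
    proof (rule sum.reindex_bij_witness[of _ "\<lambda>v. inv v \<otimes> y" "\<lambda>x. y \<otimes> inv x"])
      fix x assume x: "x \<in> {x \<in> carrier G. y \<otimes> inv x \<in> Y}"
      then show "inv (y \<otimes> inv x) \<otimes> y = x"
        using y by (simp add: inv_mult_group m_assoc)
      show "y \<otimes> inv x \<in> Y"
        using x by simp
      show "ch z (y \<otimes> inv x) * cnj (ch z y) = cnj (ch z x)"
        using x y assms ch_mult_cnj[of z y] by (simp add: ch_mult ch_inv mult.commute)
    next
      fix v assume v: "v \<in> Y"
      then have v': "v \<in> carrier G"
        using assms by blast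
      then show "y \<otimes> inv (inv v \<otimes> y) = v"
        using y by (simp add: inv_mult_group m_assoc[symmetric])
      then show "inv v \<otimes> y \<in> {x \<in> carrier G. y \<otimes> inv x \<in> Y}"
        using v v' y by simp
    qed
    finally show ?thesis
      by (simp add: chi_set_def sum_distrib_right)
  qed
  have "fourier (\<lambda>x. \<Sum>y\<in>carrier G. (if y \<otimes> inv x \<in> Y then 1 else 0) * f y) z
    = (\<Sum>y\<in>carrier G. (\<Sum>x\<in>carrier G. cnj (ch z x) * (if y \<otimes> inv x \<in> Y then 1 else 0)) * f y)"
    unfolding fourier_def sum_distrib_left sum_distrib_right
    by (subst sum.swap) (simp only: mult.assoc)
  also have "\<dots> = (\<Sum>y\<in>carrier G. chi_set ch z Y * cnj (ch z y) * f y)"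
    by (intro sum.cong refl) (simp only: translate)
  finally show ?thesis
    by (simp only: fourier_def sum_distrib_left mult.assoc)
qed

lemma fourier_cmult: "fourier (\<lambda>x. c * f x) z = c * fourier f z"
  by (simp add: fourier_def sum_distrib_left mult_ac)

lemma fourier_add: "fourier (\<lambda>x. f x + f' x) z = fourier f z + fourier f' z"
  by (simp add: fourier_def sum.distrib distrib_left)

lemma fourier_cong:
  assumes "\<And>x. x \<in> carrier G \<Longrightarrow> f x = f' x"
  shows "fourier f z = fourier f' z"
  unfolding fourier_def using assms by (intro sum.cong) auto

lemma fourier_sums:
  assumes "\<And>x. x \<in> carrier G \<Longrightarrow> (\<lambda>k. F k x) sums f x"
  shows "(\<lambda>k. fourier (F k) z) sums fourier f z"
  unfolding fourier_def by (intro sums_sum sums_mult assms)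

end

section \<open>Blocks of the adjacency matrix\<close>

lemma sums_mexp:
  assumes "finite V" "u \<in> V" "v \<in> V"
  shows "(\<lambda>k. mpow V M k u v / fact k) sums mexp V M u v"
  unfolding mexp_def using summable_mexp[OF assms] by (rule summable_sums)

text \<open>\<open>mpow\<close> multiplies from the left, so for a fixed column each power arises by
  applying the operator to the previous column.\<close>

lemma mpow_scaled_Suc:
  "mpow V (\<lambda>u v. c * A u v) (Suc k) u w = c * mvec V A (\<lambda>u. mpow V (\<lambda>u v. c * A u v) k u w) u"
  by (simp add: mvec_def sum_distrib_left mult.assoc)

lemma mvec_unit_vec:
  assumes "finite V" "u \<in> V"
  shows "mvec V M (unit_vec u) w = M w u"
  using assms by (simp add: mvec_def unit_vec_def if_distrib cong: if_cong)

lemma exp_power_sums: "(\<lambda>k. (q::complex) ^ k / fact k) sums exp q"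
  using exp_converges[of q] by (simp add: scaleR_conv_of_real divide_inverse mult.commute)

locale semi_cayley = bicharacter G ch for G :: "('a, 'm) monoid_scheme" (structure) and ch +
  fixes R L S :: "'a set"
  assumes R_sub: "R \<subseteq> carrier G" and L_sub: "L \<subseteq> carrier G" and S_sub: "S \<subseteq> carrier G"
    and R_inv: "set_inv R = R" and L_inv: "set_inv L = L"
begin

abbreviation "V \<equiv> sc_verts G"
abbreviation "A \<equiv> adjacency (sc_edges G R L S)"
abbreviation "H t \<equiv> transition_matrix V (sc_edges G R L S) t"
abbreviation "P t \<equiv> mpow V (\<lambda>u v. \<i> * of_real t * A u v)"
abbreviation "CR \<equiv> \<lambda>z. chi_set ch z R"
abbreviation "CL \<equiv> \<lambda>z. chi_set ch z L"
abbreviation "CS \<equiv> \<lambda>z. chi_set ch z S"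

section \<open>Adjacency entries and the 2 by 2 block of each frequency\<close>

lemma finite_V: "finite V"
  by (simp add: sc_verts_def finite_carrier)

lemma swap_quotient:
  assumes "set_inv Y = Y" "x \<in> carrier G" "y \<in> carrier G" "y \<otimes> inv x \<in> Y"
  shows "x \<otimes> inv y \<in> Y"
proof -
  have "inv (y \<otimes> inv x) \<in> set_inv Y"
    using assms(4) by (auto simp: SET_INV_def)
  then show ?thesis
    using assms by (simp add: inv_mult_group)
qed

text \<open>Edges are unordered: inside a layer both quotients occur, and closure under inversion
  makes them equivalent. Between layers the quotient always has the layer 1 element first, hence the
  reversal in the last case.\<close>

lemma adjacency_sc:
  assumes x: "x \<in> carrier G" and y: "y \<in> carrier G"
  shows "A (x, 0) (y, 0) = (if y \<otimes> inv x \<in> R then 1 else 0)"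
    and "A (x, 1) (y, 1) = (if y \<otimes> inv x \<in> L then 1 else 0)"
    and "A (x, 0) (y, 1) = (if y \<otimes> inv x \<in> S then 1 else 0)"
    and "A (x, 1) (y, 0) = (if x \<otimes> inv y \<in> S then 1 else 0)"
  unfolding adjacency_def sc_edges_def
  using x y swap_quotient[OF R_inv] swap_quotient[OF L_inv]
  by (auto simp: doubleton_eq_iff)

lemma sum_V: "sum F V = (\<Sum>y\<in>carrier G. F (y, 0)) + (\<Sum>y\<in>carrier G. F (y, 1))"
proof -
  have "sum F V = (\<Sum>y\<in>carrier G. \<Sum>i\<in>{0, 1}. F (y, i))"
    unfolding sc_verts_def by (simp only: sum.cartesian_product case_prod_eta)
  then show ?thesis
    by (simp add: sum.distrib)
qed

lemma chi_set_cnj: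
  assumes "z \<in> carrier G"
  shows "cnj (CR z) = CR z" "cnj (CL z) = CL z"
  using chi_set_set_inv[OF assms R_sub] chi_set_set_inv[OF assms L_sub] by (simp_all add: R_inv L_inv)

lemma fourier_adjacency_0:
  assumes z: "z \<in> carrier G"
  shows "fourier (\<lambda>x. mvec V A f (x, 0)) z
    = CR z * fourier (\<lambda>y. f (y, 0)) z + CS z * fourier (\<lambda>y. f (y, 1)) z"
proof -
  have "fourier (\<lambda>x. mvec V A f (x, 0)) z
    = fourier (\<lambda>x. (\<Sum>y\<in>carrier G. (if y \<otimes> inv x \<in> R then 1 else 0) * f (y, 0))
        + (\<Sum>y\<in>carrier G. (if y \<otimes> inv x \<in> S then 1 else 0) * f (y, 1))) z"
    by (rule fourier_cong) (simp only: mvec_def sum_V adjacency_sc cong: sum.cong)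
  then show ?thesis
    by (simp only: fourier_add fourier_convolution[OF z R_sub] fourier_convolution[OF z S_sub])
qed

lemma fourier_adjacency_1:
  assumes z: "z \<in> carrier G"
  shows "fourier (\<lambda>x. mvec V A f (x, 1)) z
    = cnj (CS z) * fourier (\<lambda>y. f (y, 0)) z + CL z * fourier (\<lambda>y. f (y, 1)) z"
proof -
  have S_inv: "set_inv S \<subseteq> carrier G"
    using S_sub by (auto simp: SET_INV_def)
  \<comment> \<open>\<open>fourier_convolution\<close> expects a condition on
    \<open>y \<otimes> inv x\<close>; the reversal turns \<open>S\<close> into its inverse set,
    whose character sum is the conjugate.\<close>
  have mem: "x \<otimes> inv y \<in> S \<longleftrightarrow> y \<otimes> inv x \<in> set_inv S"
    if "x \<in> carrier G" "y \<in> carrier G" for x y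
  proof
    assume "x \<otimes> inv y \<in> S"
    then have "inv (x \<otimes> inv y) \<in> set_inv S"
      by (auto simp: SET_INV_def)
    then show "y \<otimes> inv x \<in> set_inv S"
      using that by (simp add: inv_mult_group)
  next
    assume "y \<otimes> inv x \<in> set_inv S"
    then obtain s where s: "s \<in> S" "y \<otimes> inv x = inv s"
      by (auto simp: SET_INV_def)
    have "inv (y \<otimes> inv x) = s"
      using s S_sub by auto
    moreover have "inv (y \<otimes> inv x) = x \<otimes> inv y"
      using that by (simp add: inv_mult_group)
    ultimately show "x \<otimes> inv y \<in> S"
      using s by simp
  qed
  have "fourier (\<lambda>x. mvec V A f (x, 1)) z
    = fourier (\<lambda>x. (\<Sum>y\<in>carrier G. (if y \<otimes> inv x \<in> set_inv S then 1 else 0) * f (y, 0))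
        + (\<Sum>y\<in>carrier G. (if y \<otimes> inv x \<in> L then 1 else 0) * f (y, 1))) z"
    by (rule fourier_cong) (simp only: mvec_def sum_V adjacency_sc mem cong: sum.cong)
  then show ?thesis
    by (simp only: fourier_add fourier_convolution[OF z L_sub] fourier_convolution[OF z S_inv]
      chi_set_set_inv[OF z S_sub])
qed

section \<open>Matrix powers and the exponential on the Fourier side\<close>

lemma fourier_mpow_Suc:
  assumes "z \<in> carrier G"
  shows "fourier (\<lambda>x. P t (Suc k) (x, 0) w) z
      = \<i> * of_real t * (CR z * fourier (\<lambda>x. P t k (x, 0) w) z + CS z * fourier (\<lambda>x. P t k (x, 1) w) z)"
    and "fourier (\<lambda>x. P t (Suc k) (x, 1) w) z
      = \<i> * of_real t * (cnj (CS z) * fourier (\<lambda>x. P t k (x, 0) w) z + CL z * fourier (\<lambda>x. P t k (x, 1) w) z)"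
  by (simp_all only: mpow_scaled_Suc fourier_cmult fourier_adjacency_0[OF assms] fourier_adjacency_1[OF assms])

lemma fourier_mpow_0:
  assumes "g \<in> carrier G"
  shows "fourier (\<lambda>x. P t 0 (x, 0) (g, 0)) z = cnj (ch z g)"
    and "fourier (\<lambda>x. P t 0 (x, 1) (g, 0)) z = 0"
  using fourier_delta[OF assms, of 1 z] by (simp_all add: fourier_def)

lemma fourier_transition_sums:
  assumes "i \<in> {0, 1}" "g \<in> carrier G"
  shows "(\<lambda>k. fourier (\<lambda>x. P t k (x, i) (g, 0)) z / fact k) sums fourier (\<lambda>x. H t (x, i) (g, 0)) z"
proof -
  have "(\<lambda>k. fourier (\<lambda>x. 1 / fact k * P t k (x, i) (g, 0)) z) sums fourier (\<lambda>x. H t (x, i) (g, 0)) z"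
  proof (rule fourier_sums)
    fix x assume "x \<in> carrier G"
    then show "(\<lambda>k. 1 / fact k * P t k (x, i) (g, 0)) sums H t (x, i) (g, 0)"
      using sums_mexp[OF finite_V, of "(x, i)" "(g, 0)"] assms
      by (simp add: transition_matrix_def sc_verts_def)
  qed
  then show ?thesis
    unfolding fourier_cmult by simp
qed

text \<open>The block is diagonal and the start vector has no component in layer 1, so none ever
  appears. This rules out zeros of \<open>CS\<close> under revival with \<beta> nonzero.\<close>

lemma fourier_transition_singular:
  assumes z: "z \<in> carrier G" and g: "g \<in> carrier G" and "CS z = 0"
  shows "fourier (\<lambda>x. H t (x, 1) (g, 0)) z = 0"
proof -
  have "fourier (\<lambda>x. P t k (x, 1) (g, 0)) z = 0" for k
    by (induction k) (simp_all only: fourier_mpow_0[OF g] fourier_mpow_Suc[OF z] \<open>CS z = 0\<close>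
      complex_cnj_zero mult_zero_left mult_zero_right add_0_left)
  then have "(\<lambda>k. 0) sums fourier (\<lambda>x. H t (x, 1) (g, 0)) z"
    using fourier_transition_sums[of 1 g t z] g by simp
  then show ?thesis
    using sums_unique2 sums_zero by blast
qed

section \<open>Spectral decomposition of the blocks\<close>

text \<open>Closure of \<open>R\<close> and \<open>L\<close> under inversion makes \<open>x\<close>
  and \<open>D\<close> real; \<open>CS z \<noteq> 0\<close> makes the bound strict, which keeps all
  denominators nonzero.\<close>

lemma spectral_data:
  assumes z: "z \<in> carrier G" and s: "CS z \<noteq> 0"
  obtains x D :: real where "sc_x ch R L z = of_real x" "sc_D ch R L S z = of_real D"
    "D\<^sup>2 = x\<^sup>2 + 4 * (cmod (CS z))\<^sup>2" "\<bar>x\<bar> < D"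
    "c_plus ch R L S z = (D + x) / (2 * D)" "c_minus ch R L S z = (D - x) / (2 * D)"
    "e_plus ch R L S z = CS z / of_real D"
proof -
  define x where "x = Re (sc_x ch R L z)"
  define D where "D = sqrt (x\<^sup>2 + 4 * (cmod (CS z))\<^sup>2)"
  have x: "sc_x ch R L z = of_real x"
    using chi_set_cnj[OF z] by (simp add: x_def sc_x_def complex_eq_iff)
  have "sc_D ch R L S z = csqrt (of_real (x\<^sup>2 + 4 * (cmod (CS z))\<^sup>2))"
    by (simp only: sc_D_def x of_real_add of_real_power of_real_mult of_real_numeral)
  then have D: "sc_D ch R L S z = of_real D"
    unfolding D_def by (subst (asm) csqrt_of_real) simp_all
  have D2: "D\<^sup>2 = x\<^sup>2 + 4 * (cmod (CS z))\<^sup>2"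
    by (simp add: D_def)
  have "sqrt (x\<^sup>2) < D"
    unfolding D_def using s by (intro real_sqrt_less_mono) simp
  then have xD: "\<bar>x\<bar> < D"
    by simp
  \<comment> \<open>Since \<open>4 * (cmod (CS z))\<^sup>2\<close> is
    \<open>(D - x) * (D + x)\<close>, each denominator acquires a factor that cancels against its
    numerator.\<close>
  have N: "(x + D)\<^sup>2 + 4 * (cmod (CS z))\<^sup>2 = (D + x) * (2 * D)"
    "(x - D)\<^sup>2 + 4 * (cmod (CS z))\<^sup>2 = (D - x) * (2 * D)"
    using D2 by (simp_all add: power2_eq_square algebra_simps)
  have cm: "(cmod (complex_of_real x + of_real D))\<^sup>2 = (x + D)\<^sup>2"
    "(cmod (complex_of_real x - of_real D))\<^sup>2 = (x - D)\<^sup>2"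
    by (simp_all flip: of_real_add of_real_diff add: norm_of_real)
  have "c_plus ch R L S z = (D + x) / (2 * D)"
    unfolding c_plus_def x D cm N using xD by (simp add: power2_eq_square add.commute)
  moreover have "c_minus ch R L S z = (D - x) / (2 * D)"
  proof -
    have "(x - D)\<^sup>2 = (D - x) * (D - x)"
      by (simp add: power2_eq_square algebra_simps)
    then show ?thesis
      unfolding c_minus_def x D cm N using xD by simp
  qed
  moreover have "e_plus ch R L S z = CS z / of_real D"
  proof -
    have "complex_of_real D + of_real x \<noteq> 0"
      using xD by (simp flip: of_real_add)
    then show ?thesis
      unfolding e_plus_def x D cm N using xD by (simp add: add.commute)
  qed
  ultimately show ?thesis
    using that x D D2 xD by blast
qed

text \<open>The first three facts are trace 1, nonvanishing off the diagonal and determinant 0 of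
  the projection. The next four say that \<open>(cp, cnj e)\<close> and \<open>(cm, - cnj e)\<close>
  are eigenvectors of the block for \<open>lp\<close> and \<open>lm\<close>.\<close>

lemma spectral_identities:
  assumes z: "z \<in> carrier G" and s: "CS z \<noteq> 0"
  defines "cp \<equiv> complex_of_real (c_plus ch R L S z)"
    and "cm \<equiv> complex_of_real (c_minus ch R L S z)"
    and "e \<equiv> e_plus ch R L S z"
    and "lp \<equiv> lam_plus ch R L S z" and "lm \<equiv> lam_minus ch R L S z"
  shows "cp + cm = 1" "e \<noteq> 0" "e * cnj e = cp * cm"
    "CR z * cp + CS z * cnj e = lp * cp" "CR z * cm - CS z * cnj e = lm * cm"
    "cnj (CS z) * cp + CL z * cnj e = lp * cnj e" "cnj (CS z) * cm - CL z * cnj e = - lm * cnj e"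
    "lp \<in> \<real>" "lm \<in> \<real>"
proof -
  obtain x D :: real where x: "sc_x ch R L z = of_real x" and D: "sc_D ch R L S z = of_real D"
    and D2: "D\<^sup>2 = x\<^sup>2 + 4 * (cmod (CS z))\<^sup>2" and xD: "\<bar>x\<bar> < D"
    and c: "c_plus ch R L S z = (D + x) / (2 * D)" "c_minus ch R L S z = (D - x) / (2 * D)"
    and e: "e_plus ch R L S z = CS z / of_real D"
    using spectral_data[OF z s] by blast
  have CR: "CR z = CL z + of_real x"
    using x by (simp add: sc_x_def algebra_simps)
  have SS: "4 * (CS z * cnj (CS z)) = (of_real D)\<^sup>2 - (of_real x)\<^sup>2"
    using D2 by (simp add: complex_norm_square[symmetric] flip: of_real_power of_real_diff)
  have D0: "complex_of_real D \<noteq> 0"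
    using xD by auto
  have defs: "cp = (of_real D + of_real x) / (2 * of_real D)" "cm = (of_real D - of_real x) / (2 * of_real D)"
    "e = CS z / of_real D" "cnj e = cnj (CS z) / of_real D"
    "lp = (2 * CL z + of_real x + of_real D) / 2" "lm = (2 * CL z + of_real x - of_real D) / 2"
    by (simp_all add: cp_def cm_def e_def c e lp_def lm_def lam_plus_def lam_minus_def D CR)
  have SE: "CS z * cnj e = ((of_real D)\<^sup>2 - (of_real x)\<^sup>2) / (4 * of_real D)"
    unfolding SS[symmetric] using D0 by (simp add: defs)
  show "cp + cm = 1"
    using D0 by (simp add: defs field_simps)
  show "e \<noteq> 0"
    using D0 s by (simp add: defs)
  have "e * cnj e = 4 * (CS z * cnj (CS z)) / (4 * (of_real D)\<^sup>2)"
    using D0 by (simp add: defs power2_eq_square)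
  then show "e * cnj e = cp * cm"
    unfolding SS using D0 by (simp add: defs power2_eq_square field_simps)
  have K: "2 * of_real D * cp = of_real D + of_real x" "2 * of_real D * cm = of_real D - of_real x"
    using D0 by (simp_all add: defs)
  have l: "2 * lp = 2 * CL z + of_real x + of_real D" "2 * lm = 2 * CL z + of_real x - of_real D"
    by (simp_all add: defs)
  \<comment> \<open>The factor \<open>4 * of_real D\<close> clears the denominators of
    \<open>cp\<close> and of \<open>SE\<close>; it is nonzero and is cancelled at the end.\<close>
  have "4 * of_real D * (CR z * cp + CS z * cnj e) = 2 * CR z * (2 * of_real D * cp) + 4 * of_real D * (CS z * cnj e)"
    by (simp add: distrib_left mult_ac)
  also have "\<dots> = 2 * lp * (2 * of_real D * cp)"
    unfolding K SE CR l using D0 by (simp add: power2_eq_square) (simp add: algebra_simps)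
  also have "\<dots> = 4 * of_real D * (lp * cp)"
    by simp
  finally show "CR z * cp + CS z * cnj e = lp * cp"
    using D0 by simp
  have "4 * of_real D * (CR z * cm - CS z * cnj e) = 2 * CR z * (2 * of_real D * cm) - 4 * of_real D * (CS z * cnj e)"
    by (simp add: right_diff_distrib mult_ac)
  also have "\<dots> = 2 * lm * (2 * of_real D * cm)"
    unfolding K SE CR l using D0 by (simp add: power2_eq_square) (simp add: algebra_simps)
  also have "\<dots> = 4 * of_real D * (lm * cm)"
    by simp
  finally show "CR z * cm - CS z * cnj e = lm * cm"
    using D0 by simp
  show "cnj (CS z) * cp + CL z * cnj e = lp * cnj e"
    using D0 by (simp add: defs field_simps)
  show "cnj (CS z) * cm - CL z * cnj e = - lm * cnj e"
    using D0 by (simp add: defs field_simps)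
  have "CL z \<in> \<real>"
    using chi_set_cnj[OF z] by (simp add: Reals_cnj_iff)
  then show "lp \<in> \<real>" "lm \<in> \<real>"
    by (simp_all add: defs)
qed

text \<open>Up to the factor \<open>cnj (ch z g)\<close> the start vector is
  \<open>(1, 0) = (cp, cnj e) + (cm, - cnj e)\<close>, a sum of two eigenvectors, on which the
  exponential acts by \<open>p\<close> and \<open>m\<close>.\<close>

lemma fourier_transition:
  fixes t :: real and p m :: complex
  assumes z: "z \<in> carrier G" and g: "g \<in> carrier G" and s: "CS z \<noteq> 0"
  defines "p \<equiv> exp (\<i> * of_real t * lam_plus ch R L S z)"
    and "m \<equiv> exp (\<i> * of_real t * lam_minus ch R L S z)"
  shows "fourier (\<lambda>x. H t (x, 0) (g, 0)) z
      = cnj (ch z g) * (c_plus ch R L S z * p + c_minus ch R L S z * m)"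
    and "fourier (\<lambda>x. H t (x, 1) (g, 0)) z = cnj (ch z g) * (cnj (e_plus ch R L S z) * (p - m))"
proof -
  define cp cm e where defs: "cp = complex_of_real (c_plus ch R L S z)"
    "cm = complex_of_real (c_minus ch R L S z)" "e = e_plus ch R L S z"
  define q q' where q_defs: "q = \<i> * of_real t * lam_plus ch R L S z"
    "q' = \<i> * of_real t * lam_minus ch R L S z"
  note ids = spectral_identities[OF z s, folded defs]
  let ?c = "\<i> * complex_of_real t"
  have powers: "fourier (\<lambda>x. P t k (x, 0) (g, 0)) z = cnj (ch z g) * (cp * q ^ k + cm * q' ^ k) \<and>
    fourier (\<lambda>x. P t k (x, 1) (g, 0)) z = cnj (ch z g) * (cnj e * (q ^ k - q' ^ k))" for k
  proof (induction k)
    case 0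
    show ?case
      using ids(1) by (simp only: fourier_mpow_0[OF g]) simp
  next
    case (Suc k)
    have "fourier (\<lambda>x. P t (Suc k) (x, 0) (g, 0)) z
      = cnj (ch z g) * (?c * (CR z * cp + CS z * cnj e) * q ^ k + ?c * (CR z * cm - CS z * cnj e) * q' ^ k)"
      by (simp only: fourier_mpow_Suc[OF z] Suc) (simp add: algebra_simps)
    moreover have "fourier (\<lambda>x. P t (Suc k) (x, 1) (g, 0)) z
      = cnj (ch z g) * (?c * (cnj (CS z) * cp + CL z * cnj e) * q ^ k
          + ?c * (cnj (CS z) * cm - CL z * cnj e) * q' ^ k)"
      by (simp only: fourier_mpow_Suc[OF z] Suc) (simp add: algebra_simps)
    ultimately show ?case
      by (simp only: ids) (simp add: q_defs algebra_simps)
  qed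
  have F: "fourier (\<lambda>x. P t k (x, 0) (g, 0)) z / fact k
      = cnj (ch z g) * (cp * (q ^ k / fact k) + cm * (q' ^ k / fact k))"
    "fourier (\<lambda>x. P t k (x, 1) (g, 0)) z / fact k
      = cnj (ch z g) * (cnj e * (q ^ k / fact k - q' ^ k / fact k))" for k
    by (simp_all only: conjunct1[OF powers] conjunct2[OF powers]) (simp_all add: field_simps)
  have "(\<lambda>k. fourier (\<lambda>x. P t k (x, 0) (g, 0)) z / fact k) sums (cnj (ch z g) * (cp * exp q + cm * exp q'))"
    unfolding F by (intro sums_mult sums_add exp_power_sums)
  then show "fourier (\<lambda>x. H t (x, 0) (g, 0)) z
      = cnj (ch z g) * (c_plus ch R L S z * p + c_minus ch R L S z * m)"
    using sums_unique2[OF fourier_transition_sums[OF _ g, of 0 t z]]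
    by (simp add: p_def m_def defs q_defs)
  have "(\<lambda>k. fourier (\<lambda>x. P t k (x, 1) (g, 0)) z / fact k) sums (cnj (ch z g) * (cnj e * (exp q - exp q')))"
    unfolding F by (intro sums_mult sums_diff exp_power_sums)
  then show "fourier (\<lambda>x. H t (x, 1) (g, 0)) z = cnj (ch z g) * (cnj (e_plus ch R L S z) * (p - m))"
    using sums_unique2[OF fourier_transition_sums[OF _ g, of 1 t z]]
    by (simp add: p_def m_def defs q_defs)
qed

section \<open>Revival\<close>

text \<open>The column at \<open>(g, 0)\<close> must be \<alpha> times a delta at \<open>g\<close>
  on layer 0 and \<beta> times a delta at \<open>h\<close> on layer 1; the transform is injective on
  each layer.\<close>

lemma revival_iff_fourier:
  assumes g: "g \<in> carrier G" and h: "h \<in> carrier G"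
  shows "revival V (sc_edges G R L S) \<alpha> \<beta> (g, 0) (h, 1) t \<longleftrightarrow>
    (\<forall>z\<in>carrier G. fourier (\<lambda>x. H t (x, 0) (g, 0)) z = \<alpha> * cnj (ch z g) \<and>
       fourier (\<lambda>x. H t (x, 1) (g, 0)) z = \<beta> * cnj (ch z h)) \<and>
    (cmod \<alpha>)\<^sup>2 + (cmod \<beta>)\<^sup>2 = 1"
proof -
  have V: "(g, 0) \<in> V" "(h, 1) \<in> V"
    using g h by (auto simp: sc_verts_def)
  have "(\<forall>w\<in>V. mvec V (H t) (unit_vec (g, 0)) w = \<alpha> * unit_vec (g, 0) w + \<beta> * unit_vec (h, 1) w)
    \<longleftrightarrow> (\<forall>x\<in>carrier G. H t (x, 0) (g, 0) = (if x = g then \<alpha> else 0)) \<and>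
        (\<forall>x\<in>carrier G. H t (x, 1) (g, 0) = (if x = h then \<beta> else 0))"
    by (auto simp: mvec_unit_vec[OF finite_V V(1)]) (auto simp: sc_verts_def unit_vec_def)
  also have "\<dots> \<longleftrightarrow> (\<forall>z\<in>carrier G. fourier (\<lambda>x. H t (x, 0) (g, 0)) z = \<alpha> * cnj (ch z g)) \<and>
       (\<forall>z\<in>carrier G. fourier (\<lambda>x. H t (x, 1) (g, 0)) z = \<beta> * cnj (ch z h))"
    using fourier_eq_iff[of "\<lambda>x. H t (x, 0) (g, 0)" "\<lambda>x. if x = g then \<alpha> else 0"]
      fourier_eq_iff[of "\<lambda>x. H t (x, 1) (g, 0)" "\<lambda>x. if x = h then \<beta> else 0"]
    unfolding fourier_delta[OF g] fourier_delta[OF h] by blast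
  finally show ?thesis
    unfolding revival_def using V by auto
qed

text \<open>Dividing by \<open>cnj (ch z g)\<close> leaves \<open>ch z g * cnj (ch z h)\<close>
  beside \<beta>; this is the origin of the quotient \<open>g \<otimes> inv h\<close>.\<close>

lemma column_iff:
  fixes \<alpha> \<beta> :: complex and t :: real and p m :: complex
  assumes z: "z \<in> carrier G" and g: "g \<in> carrier G" and h: "h \<in> carrier G" and s: "CS z \<noteq> 0"
  defines "p \<equiv> exp (\<i> * of_real t * lam_plus ch R L S z)"
    and "m \<equiv> exp (\<i> * of_real t * lam_minus ch R L S z)"
  shows "fourier (\<lambda>x. H t (x, 0) (g, 0)) z = \<alpha> * cnj (ch z g) \<and>
      fourier (\<lambda>x. H t (x, 1) (g, 0)) z = \<beta> * cnj (ch z h) \<longleftrightarrow>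
    of_real (c_plus ch R L S z) * p + of_real (c_minus ch R L S z) * m = \<alpha> \<and>
      cnj (e_plus ch R L S z) * (p - m) = \<beta> * ch (g \<otimes> inv h) z"
proof -
  have "ch (g \<otimes> inv h) z = ch z g * cnj (ch z h)"
    using z g h by (simp add: ch_commute[of _ z] ch_mult ch_inv)
  then have "cnj (ch z g) * (\<beta> * ch (g \<otimes> inv h) z) = \<beta> * cnj (ch z h)"
    using ch_mult_cnj[of z g] by (simp add: mult_ac)
  moreover have "cnj (ch z g) \<noteq> 0"
    using ch_nonzero by simp
  ultimately have "cnj (ch z g) * (cnj (e_plus ch R L S z) * (p - m)) = \<beta> * cnj (ch z h) \<longleftrightarrow>
      cnj (e_plus ch R L S z) * (p - m) = \<beta> * ch (g \<otimes> inv h) z"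
    by (metis mult_left_cancel)
  then show ?thesis
    using fourier_transition[OF z g s, of t, folded p_def m_def] \<open>cnj (ch z g) \<noteq> 0\<close>
    by (simp add: mult.commute[of \<alpha>])
qed

text \<open>Passing to \<open>inv z\<close> conjugates \<open>CS z\<close> and fixes the real sums
  over \<open>R\<close> and \<open>L\<close>. The eigenvalues depend on \<open>CS z\<close> through
  its modulus only.\<close>

lemma spectral_inv:
  assumes z: "z \<in> carrier G" and s: "CS z \<noteq> 0"
  shows "lam_plus ch R L S (inv z) = lam_plus ch R L S z"
    and "lam_minus ch R L S (inv z) = lam_minus ch R L S z"
    and "e_plus ch R L S (inv z) = cnj (e_plus ch R L S z)"
proof -
  have C: "CR (inv z) = CR z" "CL (inv z) = CL z" "CS (inv z) = cnj (CS z)"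
    using chi_set_cnj[OF z] chi_set_inv_left[OF z] R_sub L_sub S_sub by simp_all
  have xD: "sc_x ch R L (inv z) = sc_x ch R L z" "sc_D ch R L S (inv z) = sc_D ch R L S z"
    by (simp_all add: sc_x_def sc_D_def C)
  show "lam_plus ch R L S (inv z) = lam_plus ch R L S z" "lam_minus ch R L S (inv z) = lam_minus ch R L S z"
    by (simp_all add: lam_plus_def lam_minus_def xD C)
  obtain x D :: real where "sc_x ch R L z = of_real x" "sc_D ch R L S z = of_real D"
    using spectral_data[OF z s] by blast
  then show "e_plus ch R L S (inv z) = cnj (e_plus ch R L S z)"
    by (simp add: e_plus_def xD C)
qed

text \<open>\<open>e_plus\<close> is \<open>CS z\<close> divided by the positive real
  \<open>D\<close>, so both have the same phase.\<close>

lemma chi_set_real_iff: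
  assumes z: "z \<in> carrier G" and s: "CS z \<noteq> 0"
  shows "CS z * w \<in> \<real> \<longleftrightarrow> e_plus ch R L S z * w = cnj (e_plus ch R L S z * w)"
proof -
  obtain x D :: real where D: "\<bar>x\<bar> < D" "e_plus ch R L S z = CS z / of_real D"
    using spectral_data[OF z s] by metis
  have "CS z * w \<in> \<real> \<longleftrightarrow> CS z * w = cnj (CS z * w)"
    by (auto simp: Reals_cnj_iff)
  also have "\<dots> \<longleftrightarrow> CS z * w / of_real D = cnj (CS z * w) / of_real D"
    using D by auto
  finally show ?thesis
    by (simp add: D)
qed

text \<open>The equations at \<open>z\<close> and \<open>inv z\<close> share the same
  \<open>d\<close>, but one has \<open>cnj e\<close> and \<open>w\<close>, the other
  \<open>e\<close> and \<open>cnj w\<close>. Multiplying them crosswise gives the claim.\<close>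

lemma revival_chi_set_real:
  assumes z: "z \<in> carrier G" and g: "g \<in> carrier G" and h: "h \<in> carrier G" and s: "CS z \<noteq> 0"
    and \<beta>: "\<beta> \<noteq> 0" and rev: "revival V (sc_edges G R L S) \<alpha> \<beta> (g, 0) (h, 1) t"
  shows "CS z * ch (g \<otimes> inv h) z \<in> \<real>"
proof -
  define w e where "w = ch (g \<otimes> inv h) z" and "e = e_plus ch R L S z"
  define d where "d = exp (\<i> * of_real t * lam_plus ch R L S z) - exp (\<i> * of_real t * lam_minus ch R L S z)"
  have a: "g \<otimes> inv h \<in> carrier G"
    using g h by simp
  have s': "CS (inv z) \<noteq> 0"
    using s chi_set_inv_left[OF z S_sub] by simp
  note F = rev[unfolded revival_iff_fourier[OF g h], THEN conjunct1, rule_format]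
  have 1: "cnj e * d = \<beta> * w"
    using F[OF z] unfolding column_iff[OF z g h s] by (simp add: e_def d_def w_def)
  have "ch (g \<otimes> inv h) (inv z) = cnj w"
    using ch_inv[OF a z] by (simp add: w_def)
  then have 2: "e * d = \<beta> * cnj w"
    using F[OF inv_closed[OF z]] unfolding column_iff[OF inv_closed[OF z] g h s']
    by (simp add: e_def d_def spectral_inv[OF z s])
  \<comment> \<open>Otherwise \<open>\<beta> * w\<close> would vanish, although \<beta> is nonzero
    and \<open>w\<close> is unimodular.\<close>
  have "d \<noteq> 0"
    using 1 \<beta> ch_nonzero[of "g \<otimes> inv h" z] by (auto simp: w_def)
  moreover have "d * \<beta> * (e * w) = d * \<beta> * cnj (e * w)"
  proof -
    have "d * \<beta> * (e * w) = (e * d) * (\<beta> * w)"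
      by (simp add: mult_ac)
    also have "\<dots> = (\<beta> * cnj w) * (cnj e * d)"
      by (simp only: 1 2)
    finally show ?thesis
      by (simp add: mult_ac)
  qed
  ultimately have "e * w = cnj (e * w)"
    using \<beta> by simp
  then show ?thesis
    using chi_set_real_iff[OF z s] by (simp add: e_def w_def)
qed

text \<open>A linear system in \<open>p\<close> and \<open>m\<close>. Reality of
  \<open>CS z * w\<close> lets \<open>\<beta> * w / cnj e\<close> be written as
  \<open>\<beta> * cnj w / e\<close>, the form in the conclusion.\<close>

lemma eigenvalue_iff:
  fixes \<alpha> \<beta> p m w :: complex
  assumes z: "z \<in> carrier G" and s: "CS z \<noteq> 0" and real: "CS z * w \<in> \<real>"
  shows "of_real (c_plus ch R L S z) * p + of_real (c_minus ch R L S z) * m = \<alpha> \<and>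
      cnj (e_plus ch R L S z) * (p - m) = \<beta> * w \<longleftrightarrow>
    p = \<alpha> + of_real (c_minus ch R L S z) * inverse (e_plus ch R L S z) * \<beta> * cnj w \<and>
      m = \<alpha> - of_real (c_plus ch R L S z) * inverse (e_plus ch R L S z) * \<beta> * cnj w"
    (is "?cp * p + ?cm * m = \<alpha> \<and> _ \<longleftrightarrow> _")
proof -
  let ?e = "e_plus ch R L S z"
  define y where "y = inverse ?e * \<beta> * cnj w"
  note ids = spectral_identities[OF z s]
  have "?e * w = cnj ?e * cnj w"
    using real chi_set_real_iff[OF z s] by simp
  then have y: "cnj ?e * y = \<beta> * w"
    using ids(2) by (simp add: y_def field_simps)
  have "cnj ?e * (p - m) = \<beta> * w \<longleftrightarrow> p - m = y"
    using ids(2) unfolding y[symmetric] by simp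
  \<comment> \<open>The weights sum to 1, so the weighted mean \<alpha> and the difference
    \<open>y\<close> determine \<open>p\<close> and \<open>m\<close>.\<close>
  moreover have "?cp * p + ?cm * m = \<alpha> \<and> p - m = y \<longleftrightarrow> p = \<alpha> + ?cm * y \<and> m = \<alpha> - ?cp * y"
  proof safe
    show "p = ?cp * p + ?cm * m + ?cm * (p - m)"
      using ids(1) by (simp add: right_diff_distrib flip: distrib_right)
    have "?cm + ?cp = 1"
      using ids(1) by (simp only: add.commute)
    then show "m = ?cp * p + ?cm * m - ?cp * (p - m)"
      by (simp add: right_diff_distrib flip: distrib_right)
    have "?cp * (\<alpha> + ?cm * y) + ?cm * (\<alpha> - ?cp * y) = (?cp + ?cm) * \<alpha>"
      by (simp add: algebra_simps)
    then show "?cp * (\<alpha> + ?cm * y) + ?cm * (\<alpha> - ?cp * y) = \<alpha>"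
      by (simp add: ids(1))
    have "\<alpha> + ?cm * y - (\<alpha> - ?cp * y) = (?cp + ?cm) * y"
      by (simp add: algebra_simps)
    then show "\<alpha> + ?cm * y - (\<alpha> - ?cp * y) = y"
      by (simp add: ids(1))
  qed
  ultimately show ?thesis
    by (simp add: y_def mult.assoc)
qed

text \<open>\<alpha> and \<open>\<beta> * w\<close> form a column of a unitary matrix. Concretely,
  the terms in \<open>p * cnj m\<close> cancel between the two squared moduli and leave
  \<open>(?cp + ?cm)\<^sup>2\<close>.\<close>

lemma column_norm:
  fixes \<alpha> \<beta> p m w :: complex and t :: real
  assumes z: "z \<in> carrier G" and s: "CS z \<noteq> 0" and w: "cmod w = 1"
  defines "p \<equiv> exp (\<i> * of_real t * lam_plus ch R L S z)"
    and "m \<equiv> exp (\<i> * of_real t * lam_minus ch R L S z)"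
  assumes \<alpha>: "of_real (c_plus ch R L S z) * p + of_real (c_minus ch R L S z) * m = \<alpha>"
    and \<beta>: "cnj (e_plus ch R L S z) * (p - m) = \<beta> * w"
  shows "(cmod \<alpha>)\<^sup>2 + (cmod \<beta>)\<^sup>2 = 1"
proof -
  let ?cp = "complex_of_real (c_plus ch R L S z)" and ?cm = "complex_of_real (c_minus ch R L S z)"
  let ?e = "e_plus ch R L S z"
  note ids = spectral_identities[OF z s]
  have "cmod p = 1" "cmod m = 1"
    using ids(8,9) by (auto simp: p_def m_def elim!: Reals_cases)
  then have pm: "p * cnj p = 1" "m * cnj m = 1"
    by (simp_all add: complex_norm_square[symmetric])
  have "complex_of_real ((cmod \<alpha>)\<^sup>2) = (?cp * p + ?cm * m) * (?cp * cnj p + ?cm * cnj m)"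
    by (simp only: complex_norm_square \<alpha>[symmetric]) simp
  also have "\<dots> = ?cp * ?cp * (p * cnj p) + ?cm * ?cm * (m * cnj m) + ?cp * ?cm * (p * cnj m + m * cnj p)"
    by (simp add: algebra_simps)
  finally have A: "complex_of_real ((cmod \<alpha>)\<^sup>2) = ?cp * ?cp + ?cm * ?cm + ?cp * ?cm * (p * cnj m + m * cnj p)"
    by (simp add: pm)
  have "complex_of_real ((cmod \<beta>)\<^sup>2) = of_real ((cmod (\<beta> * w))\<^sup>2)"
    by (simp add: norm_mult w)
  also have "\<dots> = (?e * cnj ?e) * (p * cnj p + m * cnj m - (p * cnj m + m * cnj p))"
    by (simp only: complex_norm_square \<beta>[symmetric]) (simp add: algebra_simps)
  finally have B: "complex_of_real ((cmod \<beta>)\<^sup>2) = ?cp * ?cm * (2 - (p * cnj m + m * cnj p))"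
    by (simp add: pm ids(3))
  have "complex_of_real ((cmod \<alpha>)\<^sup>2 + (cmod \<beta>)\<^sup>2) = (?cp + ?cm) * (?cp + ?cm)"
    unfolding of_real_add A B by (simp add: algebra_simps)
  also have "\<dots> = of_real 1"
    by (simp add: ids(1))
  finally show ?thesis
    by (simp only: of_real_eq_iff)
qed

theorem revival_iff:
  assumes g: "g \<in> carrier G" and h: "h \<in> carrier G" and \<beta>: "\<beta> \<noteq> 0"
  defines "a \<equiv> g \<otimes> inv h"
  shows "revival V (sc_edges G R L S) \<alpha> \<beta> (g, 0) (h, 1) t \<longleftrightarrow>
    (\<forall>z\<in>carrier G. CS z \<noteq> 0 \<and> CS z * ch a z \<in> \<real>) \<and>
    (\<forall>z\<in>carrier G.
       exp (\<i> * of_real t * lam_plus ch R L S z) =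
         \<alpha> + of_real (c_minus ch R L S z) * inverse (e_plus ch R L S z) * \<beta> * cnj (ch a z) \<and>
       exp (\<i> * of_real t * lam_minus ch R L S z) =
         \<alpha> - of_real (c_plus ch R L S z) * inverse (e_plus ch R L S z) * \<beta> * cnj (ch a z))"
    (is "?rev \<longleftrightarrow> ?real \<and> (\<forall>z\<in>carrier G. ?eig z)")
proof
  assume rev: ?rev
  note F = rev[unfolded revival_iff_fourier[OF g h], THEN conjunct1, rule_format]
  have nz: "CS z \<noteq> 0" if z: "z \<in> carrier G" for z
    using F[OF z] fourier_transition_singular[OF z g] \<beta> ch_nonzero by auto
  have real: ?real
    using nz revival_chi_set_real[OF _ g h _ \<beta> rev] unfolding a_def by blast
  have "?eig z" if z: "z \<in> carrier G" for z
    using F[OF z] eigenvalue_iff[OF z nz[OF z]] real z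
    unfolding column_iff[OF z g h nz[OF z]] a_def by blast
  with real show "?real \<and> (\<forall>z\<in>carrier G. ?eig z)"
    by blast
next
  assume rhs: "?real \<and> (\<forall>z\<in>carrier G. ?eig z)"
  have col: "of_real (c_plus ch R L S z) * exp (\<i> * of_real t * lam_plus ch R L S z)
        + of_real (c_minus ch R L S z) * exp (\<i> * of_real t * lam_minus ch R L S z) = \<alpha> \<and>
      cnj (e_plus ch R L S z) * (exp (\<i> * of_real t * lam_plus ch R L S z)
        - exp (\<i> * of_real t * lam_minus ch R L S z)) = \<beta> * ch a z"
    if z: "z \<in> carrier G" for z
    using rhs z eigenvalue_iff[OF z] by blast
  \<comment> \<open>The right-hand side does not state the norm condition; the block at
    \<open>\<one>\<close> supplies it.\<close>
  have "(cmod \<alpha>)\<^sup>2 + (cmod \<beta>)\<^sup>2 = 1"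
    using column_norm[OF one_closed _ cmod_ch] col[OF one_closed] rhs one_closed by blast
  moreover have "fourier (\<lambda>x. H t (x, 0) (g, 0)) z = \<alpha> * cnj (ch z g) \<and>
      fourier (\<lambda>x. H t (x, 1) (g, 0)) z = \<beta> * cnj (ch z h)" if z: "z \<in> carrier G" for z
    using rhs z col[OF z] column_iff[OF z g h] unfolding a_def by blast
  ultimately show ?rev
    unfolding revival_iff_fourier[OF g h] by blast
qed

end

section \<open>The bicharacter of a product of cyclic groups\<close>

lemma omega_nonzero: "omega m \<noteq> 0"
  by (simp add: omega_def)

lemma cmod_omega: "cmod (omega m) = 1"
  by (simp add: omega_def)

lemma omega_powi: "omega m powi k = exp (2 * of_real pi * \<i> * of_int k / of_nat m)"
  by (simp add: omega_def exp_power_int mult_ac)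

text \<open>Coordinates of a product are reduced modulo \<open>m\<close>, and \<open>omega m\<close>
  is an \<open>m\<close>-th root of unity. For \<open>m = 0\<close> the reduction is the
  identity.\<close>

lemma omega_powi_mod: "omega m powi (k * (j mod int m)) = omega m powi (k * j)"
proof (cases "m = 0")
  case False
  have "omega m powi int m = 1"
    unfolding omega_powi using False by simp
  then have "omega m powi (int m * i) = 1" for i
    by (simp add: power_int_mult)
  moreover have "k * j = k * (j mod int m) + int m * (k * (j div int m))"
    by (metis distrib_left mod_mult_div_eq mult.left_commute)
  ultimately show ?thesis
    by (simp add: power_int_add omega_nonzero)
qed simp

lemma omega_powi_neq_1:
  assumes "0 < k" "k < int m"
  shows "omega m powi k \<noteq> 1"
proof
  assume "omega m powi k = 1"
  then obtain n :: int where "2 * pi * of_int k / of_nat m = of_int (2 * n) * pi"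
    by (auto simp: omega_powi exp_eq_1)
  then have "real_of_int k = of_int (n * int m)"
    using assms by (simp add: field_simps)
  then have "k = n * int m"
    by (simp only: of_int_eq_iff)
  with assms show False
    by (metis zdvd_not_zless dvd_triv_right)
qed

text \<open>For nondegeneracy, pick a nonzero coordinate \<open>s\<close> of \<open>x\<close> and
  pair \<open>x\<close> with the element whose coordinates are the unit vector at \<open>s\<close>:
  only \<open>omega (ns s) powi \<phi> x s\<close> survives.\<close>

lemma bicharacter_chi:
  fixes G :: "('a, 'm) monoid_scheme" (structure)
  assumes "comm_group G" and "finite (carrier G)"
    and ns: "\<forall>s<r. ns s > 0" and \<phi>: "\<phi> \<in> iso G (cyclic_product r ns)"
  shows "bicharacter G (chi r ns \<phi>)"
proof -
  interpret comm_group G by fact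
  have bij: "bij_betw \<phi> (carrier G) (carrier (cyclic_product r ns))"
    and hom: "\<phi> \<in> hom G (cyclic_product r ns)"
    using \<phi> by (auto simp: iso_def)
  \<comment> \<open>Positivity of \<open>ns s\<close> matters: \<open>integer_mod_group 0\<close>
    consists of all integers.\<close>
  have carrier: "carrier (cyclic_product r ns) = (\<Pi>\<^sub>E s\<in>{..<r}. {0..<int (ns s)})"
    using ns by (auto simp: cyclic_product_def carrier_integer_mod_group intro!: PiE_cong)
  have mult: "\<phi> (x \<otimes> y) s = (\<phi> x s + \<phi> y s) mod int (ns s)"
    if "x \<in> carrier G" "y \<in> carrier G" "s < r" for x y s
    using hom_mult[OF hom that(1,2)] that(3) by (simp add: cyclic_product_def)
  show ?thesis
  proof
    show "finite (carrier G)" by fact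
    show "chi r ns \<phi> z (x \<otimes> y) = chi r ns \<phi> z x * chi r ns \<phi> z y"
      if "z \<in> carrier G" "x \<in> carrier G" "y \<in> carrier G" for x y z
      unfolding chi_def prod.distrib[symmetric] using that
      by (intro prod.cong) (simp_all add: mult omega_powi_mod distrib_left power_int_add omega_nonzero)
    show "chi r ns \<phi> z x = chi r ns \<phi> x z" for z x
      by (simp add: chi_def mult.commute)
    show "cmod (chi r ns \<phi> z x) = 1" for z x
      by (simp add: chi_def norm_power_int cmod_omega flip: prod_norm)
    show "\<exists>z\<in>carrier G. chi r ns \<phi> z x \<noteq> 1" if x: "x \<in> carrier G" "x \<noteq> \<one>" for x
    proof -
      have \<phi>x: "\<phi> x \<in> (\<Pi>\<^sub>E s\<in>{..<r}. {0..<int (ns s)})"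
        using bij_betwE[OF bij] x carrier by blast
      \<comment> \<open>If all coordinates were 0, \<open>x \<otimes> x\<close> and \<open>x\<close>
        would have the same image, both being \<open>undefined\<close> from index \<open>r\<close>
        on; then \<open>x\<close> is idempotent, hence the identity.\<close>
      have "\<exists>s<r. \<phi> x s \<noteq> 0"
      proof (rule ccontr)
        assume "\<not> (\<exists>s<r. \<phi> x s \<noteq> 0)"
        then have "\<phi> (x \<otimes> x) s = \<phi> x s" for s
          using mult[OF x(1) x(1), of s] hom_mult[OF hom x(1) x(1)] PiE_arb[OF \<phi>x]
          by (cases "s < r") (auto simp: cyclic_product_def)
        then have "\<phi> (x \<otimes> x) = \<phi> x"
          by blast
        then have "x \<otimes> x = x"
          using bij x by (meson bij_betw_def inj_onD m_closed)
        then show False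
          using x by simp
      qed
      then obtain s where s: "s < r" "\<phi> x s \<noteq> 0"
        by blast
      then have s': "0 < \<phi> x s" "\<phi> x s < int (ns s)"
        using PiE_mem[OF \<phi>x, of s] by auto
      \<comment> \<open>The restriction makes \<open>f\<close> extensional; the entry 1 is
        admissible because \<open>s'\<close> forces \<open>ns s > 1\<close>.\<close>
      define f where "f = (\<lambda>i\<in>{..<r}. if i = s then 1 else (0::int))"
      have "f \<in> carrier (cyclic_product r ns)"
        using ns s' unfolding carrier f_def by auto
      then obtain z where z: "z \<in> carrier G" "\<phi> z = f"
        using bij by (metis bij_betw_iff_bijections)
      have "chi r ns \<phi> z x = (\<Prod>i<r. if i = s then omega (ns s) powi \<phi> x s else 1)"
        unfolding chi_def z(2) f_def by (intro prod.cong) auto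
      then have "chi r ns \<phi> z x = omega (ns s) powi \<phi> x s"
        using s(1) by simp
      then show ?thesis
        using omega_powi_neq_1[OF s'] by (intro bexI[OF _ z(1)]) simp
    qed
  qed
qed

theorem theorem3p8:
  fixes G :: "('a, 'm) monoid_scheme" (structure)
    and r :: nat and ns :: "nat \<Rightarrow> nat" and \<phi> :: "'a \<Rightarrow> nat \<Rightarrow> int"
    and R L S :: "'a set" and \<alpha> \<beta> :: complex and g h a :: 'a and t :: real
    and ch :: "'a \<Rightarrow> 'a \<Rightarrow> complex" and X :: "'a set"
  assumes "comm_group G" and "finite (carrier G)"
    and "\<forall>s<r. ns s > 0" and "\<phi> \<in> iso G (cyclic_product r ns)"
    and "R \<subseteq> carrier G" and "L \<subseteq> carrier G" and "S \<subseteq> carrier G"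
    and "set_inv R = R" and "set_inv L = L" and "\<one> \<notin> R \<union> L"
    and "\<alpha> \<noteq> 0" and "\<beta> \<noteq> 0"
    and "g \<in> carrier G" and "h \<in> carrier G"
    and "a = g \<otimes> inv h"
    and "ch = chi r ns \<phi>"
    and "X = {z \<in> carrier G. chi_set ch z S = 0}"
  shows "revival (sc_verts G) (sc_edges G R L S) \<alpha> \<beta> (g, 0) (h, 1) t \<longleftrightarrow>
    (X = {} \<and> (\<forall>z\<in>carrier G. chi_set ch z S * ch a z \<in> \<real>)) \<and>
    (\<forall>z\<in>carrier G.
       exp (\<i> * of_real t * lam_plus ch R L S z) =
         \<alpha> + of_real (c_minus ch R L S z) * inverse (e_plus ch R L S z) * \<beta> * cnj (ch a z) \<and>
       exp (\<i> * of_real t * lam_minus ch R L S z) =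
         \<alpha> - of_real (c_plus ch R L S z) * inverse (e_plus ch R L S z) * \<beta> * cnj (ch a z))"
proof -
  interpret semi_cayley G ch R L S
    using bicharacter_chi[OF assms(1-4)] assms(5-9,16)
    by (simp add: semi_cayley_def semi_cayley_axioms_def)
  show ?thesis
    using revival_iff[of g h \<beta> \<alpha> t] assms(12-15,17) by auto
qed

end
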